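(* Let $W$ be an $n\times n$ Type 1 matrix power function with coefficient matrix $A=(a_{ij})$ and powers $\gamma_{ij}$. Then $W(x)$ is positive definite for a.e. $x\in\mathbb{R}$ if and only if $A$ is positive definite and the powers $\gamma_{ij}$ satisfy $$\gamma_{ij}=\frac{\gamma_{ii}+\gamma_{jj}}{2}\qquad\text{for } 1\le i,j\le n.$$
   Context: An $n\times n$ Type 1 matrix power function is a matrix-valued function $W$ of the real variable $x$ whose $(i,j)$ entry is $a_{ij}|x|^{\gamma_{ij}}$, where each $a_{ij}\in\mathbb{C}$ and each $\gamma_{ij}\in\mathbb{R}$, for $1\le i,j\le n$. Its coefficient matrix is the $n\times n$ matrix $A=(a_{ij})_{i,j=1}^n$. A complex square matrix is positive definite if it is self-adjoint with positive eigenvalues.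
   Formalization: The condition γ_ij = (γ_ii+γ_jj)/2 is required only for those i, j with a_ij ≠ 0, since a zero coefficient leaves γ_ij arbitrary (e.g. A = I with γ_11 = γ_22 = 0, γ_12 = γ_21 = 5 violates the claim as worded). *)

theory Defs
  imports "HOL-Analysis.Analysis"
begin

definition cadjoint :: "complex^'n^'m \<Rightarrow> complex^'m^'n" where
  "cadjoint A = (\<chi> i j. cnj (A $ j $ i))"

definition self_adjoint :: "complex^'n^'n \<Rightarrow> bool" where
  "self_adjoint A \<longleftrightarrow> cadjoint A = A"

definition eigenvalue :: "complex^'n^'n \<Rightarrow> complex \<Rightarrow> bool" where
  "eigenvalue A k \<longleftrightarrow> (\<exists>v. v \<noteq> 0 \<and> A *v v = k *s v)"

definition positive_definite :: "complex^'n^'n \<Rightarrow> bool" where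
  "positive_definite A \<longleftrightarrow>
     self_adjoint A \<and> (\<forall>k. eigenvalue A k \<longrightarrow> k \<in> \<real> \<and> Re k > 0)"

(* The value at x = 0 is left unconstrained: 0 raised to a negative power has no meaning, and
   a single point is irrelevant to statements that hold almost everywhere.  For x \<noteq> 0 the
   base \<bar>x\<bar> is positive, so powr is the usual real power.  Note that W determines the
   power \<gamma>$i$j only where the coefficient A$i$j is nonzero: if A$i$j = 0, the entry vanishes
   whatever \<gamma>$i$j is. *)
definition type1_matrix_power_function ::
    "(real \<Rightarrow> complex^'n^'n) \<Rightarrow> complex^'n^'n \<Rightarrow> real^'n^'n \<Rightarrow> bool" where
  "type1_matrix_power_function W A \<gamma> \<longleftrightarrow>
     (\<forall>x i j. x \<noteq> 0 \<longrightarrow> W x $ i $ j = A $ i $ j * complex_of_real (\<bar>x\<bar> powr (\<gamma> $ i $ j)))"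

end

theory Submission
  imports Defs
begin

text \<open>
  The proof compares \<open>W x\<close> with \<open>A\<close> through the quadratic form \<open>v \<bullet> (M *v v)\<close>, where \<open>\<bullet>\<close> is the
  real inner product of \<open>complex^'n\<close>, that is, the real part of the Hermitian one.  A self-adjoint
  matrix has positive eigenvalues iff this form is positive on nonzero vectors: the minimum of the
  form on the unit sphere is itself an eigenvalue (\<open>symmetric_form_min_eigenvector\<close>,
  \<open>positive_definite_iff\<close>).  Two consequences carry the theorem.

  If the powers satisfy the averaging condition, then with \<open>d i = \<bar>x\<bar> powr (\<gamma> $ i $ i / 2)\<close> one has
  \<open>W x $ i $ j = d i * A $ i $ j * d j\<close>.  So \<open>W x\<close> is congruent to \<open>A\<close> by a positive diagonal matrix,
  and for each \<open>x \<noteq> 0\<close> one of the two is positive definite iff the other is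
  (\<open>positive_definite_diagonal_congruence_iff\<close>).

  The averaging condition is forced by the \<open>2 \<times> 2\<close> principal minors.  The Cauchy-Schwarz inequality
  for the form of \<open>W x\<close> gives
  \<open>(cmod a\<^sub>i\<^sub>j)\<^sup>2 \<le> Re a\<^sub>i\<^sub>i * Re a\<^sub>j\<^sub>j * \<bar>x\<bar> powr (\<gamma>\<^sub>i\<^sub>i + \<gamma>\<^sub>j\<^sub>j - 2 * \<gamma>\<^sub>i\<^sub>j)\<close> for almost every \<open>x\<close>.
  If the exponent is not zero, the right-hand side is arbitrarily small on some nonempty open set,
  which is not negligible; so \<open>a\<^sub>i\<^sub>j = 0\<close>.
\<close>

section \<open>Symmetric operators on real inner product spaces\<close>

text \<open>If \<open>v\<close> minimises the form of \<open>f\<close> on the unit sphere with value \<open>l\<close>, then the form of \<open>f - l\<close> is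
  nonnegative and vanishes at \<open>v\<close>.  Were \<open>u = f v - l v\<close> not zero, a small step from \<open>v\<close> in the
  direction \<open>- u\<close> would make that form negative.\<close>

lemma symmetric_form_min_eigenvector:
  fixes f :: "'a::euclidean_space \<Rightarrow> 'a"
  assumes lin: "linear f" and sym: "\<And>x y. x \<bullet> f y = f x \<bullet> y"
  obtains v l where "norm v = 1" "f v = l *\<^sub>R v" "\<And>w. l * (w \<bullet> w) \<le> w \<bullet> f w"
proof -
  interpret linear f by (rule lin)
  have "continuous_on (sphere 0 1) (\<lambda>x. x \<bullet> f x)"
    by (intro continuous_intros linear_continuous_on linear_conv_bounded_linear[THEN iffD1] lin)
  moreover have "sphere (0::'a) 1 \<noteq> {}" "compact (sphere (0::'a) 1)" by auto
  ultimately obtain v where v: "v \<in> sphere 0 1" and min: "\<And>y. y \<in> sphere 0 1 \<Longrightarrow> v \<bullet> f v \<le> y \<bullet> f y"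
    using continuous_attains_inf[of "sphere 0 1" "\<lambda>x. x \<bullet> f x"] by auto
  define l where "l = v \<bullet> f v"
  have nv: "norm v = 1" and vv: "v \<bullet> v = 1" using v by (auto simp: norm_eq_1)
  have bound: "l * (w \<bullet> w) \<le> w \<bullet> f w" for w
  proof (cases "w = 0")
    case False
    have "l \<le> (w /\<^sub>R norm w) \<bullet> f (w /\<^sub>R norm w)"
      unfolding l_def by (rule min) (use False in auto)
    then show ?thesis
      using False by (simp add: scale dot_square_norm power2_eq_square field_simps)
  qed (simp add: zero)
  define u where "u = f v - l *\<^sub>R v"
  have uv: "u \<bullet> v = 0" by (simp add: u_def inner_diff_left l_def vv inner_commute[of "f v" v])
  define K where "K = u \<bullet> f u - l * (u \<bullet> u)"
  have K: "0 \<le> K" unfolding K_def using bound[of u] by simp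
  have step: "2 * t * (u \<bullet> u) \<le> t\<^sup>2 * K" for t
  proof -
    have fv: "f v = u + l *\<^sub>R v" by (simp add: u_def)
    have "v \<bullet> f u = u \<bullet> u" using sym[of v u] uv by (simp add: fv inner_add_left inner_commute[of v u])
    moreover have "u \<bullet> f v = u \<bullet> u" using uv by (simp add: fv inner_add_right)
    ultimately have "(v - t *\<^sub>R u) \<bullet> f (v - t *\<^sub>R u) = l - 2 * t * (u \<bullet> u) + t\<^sup>2 * (u \<bullet> f u)"
      by (simp add: diff scale inner_diff_left inner_diff_right l_def power2_eq_square algebra_simps)
    moreover have "(v - t *\<^sub>R u) \<bullet> (v - t *\<^sub>R u) = 1 + t\<^sup>2 * (u \<bullet> u)"
      using uv vv by (simp add: inner_diff_left inner_diff_right inner_commute power2_eq_square)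
    ultimately show ?thesis
      using bound[of "v - t *\<^sub>R u"] by (simp add: K_def algebra_simps)
  qed
  \<comment> \<open>At this \<open>t\<close> the quadratic term in \<open>t\<close> is dominated by the linear one; the \<open>1\<close> keeps the
      denominator positive.\<close>
  define t where "t = (u \<bullet> u) / (K + 1)"
  have "t * K \<le> u \<bullet> u" using K by (simp add: t_def field_simps)
  moreover have t0: "0 \<le> t" using K by (simp add: t_def)
  ultimately have "t * (t * K) \<le> t * (u \<bullet> u)" by (intro mult_left_mono)
  then have "t * (u \<bullet> u) \<le> 0" using step[of t] by (simp add: power2_eq_square mult.assoc)
  then have "(u \<bullet> u)\<^sup>2 / (K + 1) \<le> 0" by (simp add: t_def power2_eq_square)
  then have "u = 0" using K by (simp add: divide_le_0_iff)
  then have "f v = l *\<^sub>R v" by (simp add: u_def)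
  with nv show ?thesis by (rule that) (rule bound)
qed

lemma symmetric_form_Cauchy_Schwarz:
  fixes f :: "'a::real_inner \<Rightarrow> 'a"
  assumes lin: "linear f" and sym: "\<And>x y. x \<bullet> f y = f x \<bullet> y"
    and pos: "\<And>x. x \<noteq> 0 \<Longrightarrow> 0 < x \<bullet> f x"
  shows "(x \<bullet> f y)\<^sup>2 \<le> (x \<bullet> f x) * (y \<bullet> f y)"
proof (cases "y = 0")
  case False
  interpret linear f by (rule lin)
  define p where "p = y \<bullet> f y"
  have p: "0 < p" using pos[OF False] by (simp add: p_def)
  \<comment> \<open>\<open>z / p\<close> is the component of \<open>x\<close> orthogonal to \<open>y\<close> for the form of \<open>f\<close>.\<close>
  define z where "z = p *\<^sub>R x - (x \<bullet> f y) *\<^sub>R y"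
  have "0 \<le> z \<bullet> f z" using pos[of z] by (cases "z = 0") (auto simp: zero)
  moreover have "y \<bullet> f x = x \<bullet> f y" using sym[of y x] by (simp add: inner_commute)
  then have "z \<bullet> f z = p * (p * (x \<bullet> f x) - (x \<bullet> f y)\<^sup>2)"
    by (simp add: z_def diff scale inner_diff_left inner_diff_right power2_eq_square
        p_def algebra_simps)
  ultimately have "0 \<le> p * (x \<bullet> f x) - (x \<bullet> f y)\<^sup>2"
    using p by (simp only: zero_le_mult_iff) linarith
  then show ?thesis unfolding p_def by (simp only: mult.commute diff_ge_0_iff_ge)
next
  case True
  have "f 0 = 0" using lin by (rule linear_0)
  then show ?thesis unfolding True by simp
qed

section \<open>Positive definite matrices and their quadratic forms\<close>

lemma linear_complex_matrix_vector_mult: "linear ((*v) (A :: complex^'n^'m))"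
  by (rule linearI)
    (simp_all add: vec_eq_iff matrix_vector_mult_def sum.distrib algebra_simps scaleR_sum_right)

lemma inner_cadjoint: "x \<bullet> (A *v y) = (cadjoint A *v x) \<bullet> (y :: complex^'n)"
proof -
  have c: "a \<bullet> (m * b) = (cnj m * a) \<bullet> b" for a b m :: complex
    by (simp add: inner_complex_def algebra_simps)
  have "x \<bullet> (A *v y) = (\<Sum>i\<in>UNIV. \<Sum>j\<in>UNIV. (cnj (A $ i $ j) * x $ i) \<bullet> (y $ j))"
    by (simp add: inner_vec_def matrix_vector_mult_def inner_sum_right c)
  also have "\<dots> = (cadjoint A *v x) \<bullet> y"
    by (subst sum.swap)
      (simp add: inner_vec_def matrix_vector_mult_def inner_sum_left cadjoint_def)
  finally show ?thesis .
qed

lemma self_adjoint_inner: "self_adjoint A \<Longrightarrow> x \<bullet> (A *v y) = (A *v x) \<bullet> y"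
  using inner_cadjoint[of x A y] by (simp add: self_adjoint_def)

lemma self_adjoint_iff: "self_adjoint A \<longleftrightarrow> (\<forall>i j. A $ i $ j = cnj (A $ j $ i))"
  by (simp only: self_adjoint_def cadjoint_def vec_eq_iff vec_lambda_beta) metis

text \<open>Positive eigenvalues give a positive form because the smallest value of the form on the unit
  sphere is an eigenvalue.  Conversely, at an eigenvector \<open>v\<close> for \<open>k\<close> the form has the value
  \<open>Re k * (v \<bullet> v)\<close>, and self-adjointness makes \<open>k\<close> real.\<close>

lemma positive_definite_iff:
  fixes A :: "complex^'n^'n"
  shows "positive_definite A \<longleftrightarrow> self_adjoint A \<and> (\<forall>v. v \<noteq> 0 \<longrightarrow> 0 < v \<bullet> (A *v v))"
proof (intro iffI conjI allI impI)
  assume pd: "positive_definite A"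
  then show sa: "self_adjoint A" by (simp add: positive_definite_def)
  fix w :: "complex^'n" assume w: "w \<noteq> 0"
  obtain v l where v: "norm v = 1" "A *v v = l *\<^sub>R v"
    and bound: "\<And>w. l * (w \<bullet> w) \<le> w \<bullet> (A *v w)"
    by (rule symmetric_form_min_eigenvector
        [OF linear_complex_matrix_vector_mult[of A] self_adjoint_inner[OF sa]]) (rule that)
  have "A *v v = complex_of_real l *s v"
    unfolding v(2) by (simp add: vec_eq_iff complex_eq_iff)
  moreover have "v \<noteq> 0" using v(1) by auto
  ultimately have "eigenvalue A (complex_of_real l)" unfolding eigenvalue_def by blast
  then have "0 < l" using pd by (auto simp: positive_definite_def)
  then have "0 < l * (w \<bullet> w)" using w by simp
  then show "0 < w \<bullet> (A *v w)" using bound[of w] by linarith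
next
  assume "self_adjoint A \<and> (\<forall>v. v \<noteq> 0 \<longrightarrow> 0 < v \<bullet> (A *v v))"
  then have sa: "self_adjoint A" and pos: "\<And>v. v \<noteq> 0 \<Longrightarrow> 0 < v \<bullet> (A *v v)" by auto
  have "k \<in> \<real> \<and> 0 < Re k" if ev: "eigenvalue A k" for k
  proof -
    obtain v where v: "v \<noteq> 0" "A *v v = k *s v" using ev by (auto simp: eigenvalue_def)
    have re: "x \<bullet> (k *s x) = Re k * (x \<bullet> x)" for x :: "complex^'n"
      by (simp add: inner_vec_def inner_complex_def sum_distrib_left algebra_simps)
    have im: "(\<i> *s x) \<bullet> (k *s x) = Im k * (x \<bullet> x)" for x :: "complex^'n"
      by (simp add: inner_vec_def inner_complex_def sum_distrib_left algebra_simps)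
    have "0 < Re k * (v \<bullet> v)" using pos[OF v(1)] by (simp add: v(2) re)
    then have "0 < Re k" using v(1) by (metis inner_gt_zero_iff zero_less_mult_pos2)
    \<comment> \<open>The imaginary part of the Hermitian form is the real inner product with \<open>\<i> v\<close>: moving
        first \<open>A\<close> and then \<open>\<i>\<close> to the other side shows that it equals its own negative.\<close>
    have "A *v (\<i> *s v) = \<i> *s (A *v v)" by (simp add: vector_scalar_commute)
    then have "(\<i> *s v) \<bullet> (A *v v) = (\<i> *s (A *v v)) \<bullet> v"
      using self_adjoint_inner[OF sa, of "\<i> *s v" v] by simp
    also have "\<dots> = - ((\<i> *s v) \<bullet> (A *v v))"
      by (simp add: inner_vec_def inner_complex_def sum_negf[symmetric] algebra_simps)
    finally have "Im k * (v \<bullet> v) = 0" by (simp add: v(2) im)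
    then have "Im k = 0" using v(1) by simp
    then show ?thesis using \<open>0 < Re k\<close> by (simp add: complex_is_Real_iff)
  qed
  then show "positive_definite A" using sa by (simp add: positive_definite_def)
qed

text \<open>The form of \<open>B\<close> at \<open>v\<close> is the form of \<open>A\<close> at the rescaled vector with entries \<open>d i * v $ i\<close>.\<close>

lemma positive_definite_diagonal_congruence:
  fixes A B :: "complex^'n^'n" and d :: "'n \<Rightarrow> real"
  assumes d: "\<And>i. d i \<noteq> 0"
    and B: "\<And>i j. B $ i $ j = complex_of_real (d i) * A $ i $ j * complex_of_real (d j)"
    and A: "positive_definite A"
  shows "positive_definite B"
  unfolding positive_definite_iff
proof (intro conjI allI impI)
  have sa: "\<And>i j. A $ i $ j = cnj (A $ j $ i)" and pos: "\<And>v. v \<noteq> 0 \<Longrightarrow> 0 < v \<bullet> (A *v v)"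
    using A unfolding positive_definite_iff self_adjoint_iff by blast+
  show "self_adjoint B"
    unfolding self_adjoint_iff
  proof (intro allI)
    show "B $ i $ j = cnj (B $ j $ i)" for i j
      unfolding B sa[of i j] by (simp add: mult_ac)
  qed
  fix v :: "complex^'n" assume v: "v \<noteq> 0"
  define w :: "complex^'n" where "w = (\<chi> i. complex_of_real (d i) * v $ i)"
  have Bv: "(B *v v) $ i = complex_of_real (d i) * (A *v w) $ i" for i
    by (simp add: matrix_vector_mult_def B w_def sum_distrib_left mult.assoc)
  have "v \<bullet> (B *v v) = w \<bullet> (A *v w)"
    unfolding inner_vec_def Bv by (simp add: w_def inner_complex_def algebra_simps)
  moreover have "w \<noteq> 0" using v d by (auto simp: w_def vec_eq_iff)
  ultimately show "0 < v \<bullet> (B *v v)" using pos by simp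
qed

lemma positive_definite_diagonal_congruence_iff:
  fixes A B :: "complex^'n^'n" and d :: "'n \<Rightarrow> real"
  assumes d: "\<And>i. d i \<noteq> 0"
    and B: "\<And>i j. B $ i $ j = complex_of_real (d i) * A $ i $ j * complex_of_real (d j)"
  shows "positive_definite B \<longleftrightarrow> positive_definite A"
proof
  have d': "inverse (d i) \<noteq> 0" for i using d[of i] by simp
  have A: "A $ i $ j = complex_of_real (inverse (d i)) * B $ i $ j * complex_of_real (inverse (d j))"
    for i j unfolding B using d[of i] d[of j] by simp
  show "positive_definite B \<Longrightarrow> positive_definite A"
    by (rule positive_definite_diagonal_congruence[of "\<lambda>i. inverse (d i)" A B]) (rule d', rule A)
  show "positive_definite A \<Longrightarrow> positive_definite B"
    by (rule positive_definite_diagonal_congruence[of d B A]) (rule d, rule B)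
qed

lemma inner_axis_matrix_axis:
  fixes A :: "complex^'n^'n"
  shows "axis i a \<bullet> (A *v axis j b) = a \<bullet> (A $ i $ j * b)"
proof -
  have "A $ i $ k * axis j b $ k = (if k = j then A $ i $ j * b else 0)" for k
    by (simp add: axis_def)
  then have "(A *v axis j b) $ i = A $ i $ j * b"
    by (simp add: matrix_vector_mult_def)
  then show ?thesis by (simp add: inner_axis')
qed

lemma positive_definite_diag_pos:
  assumes "positive_definite A"
  shows "0 < Re (A $ i $ i)"
proof -
  have "0 < axis i 1 \<bullet> (A *v axis i 1)"
    using assms by (simp add: positive_definite_iff axis_eq_0_iff)
  then show ?thesis by (simp add: inner_axis_matrix_axis inner_complex_def)
qed

text \<open>This is the nonnegativity of the \<open>2 \<times> 2\<close> principal minor at \<open>i\<close>, \<open>j\<close>, obtained without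
  determinants from the Cauchy-Schwarz inequality at vectors supported at \<open>i\<close> and at \<open>j\<close>.\<close>

lemma positive_definite_entry_bound:
  assumes "positive_definite A"
  shows "(cmod (A $ i $ j))\<^sup>2 \<le> Re (A $ i $ i) * Re (A $ j $ j)"
proof -
  have sa: "self_adjoint A" and pos: "\<And>v. v \<noteq> 0 \<Longrightarrow> 0 < v \<bullet> (A *v v)"
    using assms by (auto simp: positive_definite_iff)
  define m where "m = A $ i $ j"
  \<comment> \<open>Putting \<open>m\<close> itself in position \<open>i\<close> aligns the phases, so that the mixed term is \<open>(cmod m)\<^sup>2\<close>.\<close>
  have "(axis i m \<bullet> (A *v axis j 1))\<^sup>2 \<le> (axis i m \<bullet> (A *v axis i m)) * (axis j 1 \<bullet> (A *v axis j 1))"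
    using symmetric_form_Cauchy_Schwarz[OF linear_complex_matrix_vector_mult self_adjoint_inner[OF sa] pos] .
  moreover have "m \<bullet> m = (cmod m)\<^sup>2" by (simp add: dot_square_norm)
  moreover have "m \<bullet> (c * m) = Re c * (cmod m)\<^sup>2" for c
    unfolding cmod_power2 by (simp add: inner_complex_def algebra_simps power2_eq_square)
  moreover have "1 \<bullet> (c * 1) = Re c" for c
    by (simp add: inner_complex_def)
  ultimately have "((cmod m)\<^sup>2)\<^sup>2 \<le> (Re (A $ i $ i) * (cmod m)\<^sup>2) * Re (A $ j $ j)"
    unfolding inner_axis_matrix_axis m_def[symmetric] by simp
  then have cs: "(cmod m)\<^sup>2 * (cmod m)\<^sup>2 \<le> (cmod m)\<^sup>2 * (Re (A $ i $ i) * Re (A $ j $ j))"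
    by (simp add: power2_eq_square algebra_simps)
  have "(cmod m)\<^sup>2 \<le> Re (A $ i $ i) * Re (A $ j $ j)"
  proof (cases "m = 0")
    case True
    then show ?thesis using positive_definite_diag_pos[OF assms] by (simp add: less_imp_le)
  next
    case False
    then have "0 < (cmod m)\<^sup>2" by simp
    with cs show ?thesis by (rule mult_left_le_imp_le)
  qed
  then show ?thesis by (simp only: m_def)
qed

section \<open>Matrix power functions\<close>

text \<open>A property that holds almost everywhere can be used at some point of any prescribed nonempty
  open set, because such a set has positive measure.\<close>

lemma AE_lebesgue_meets_open:
  fixes S :: "'a::euclidean_space set"
  assumes "AE x in lebesgue. P x" "open S" "S \<noteq> {}"
  obtains x where "x \<in> S" "P x"
proof -
  obtain N where N: "N \<in> null_sets lebesgue" "{x \<in> space lebesgue. \<not> P x} \<subseteq> N"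
    using assms(1) by (auto simp: eventually_ae_filter)
  have "\<not> negligible S" using open_not_negligible assms(2,3) by blast
  moreover have "negligible N" using N(1) by (simp add: negligible_iff_null_sets)
  ultimately have "\<not> S \<subseteq> N" using negligible_subset by blast
  then show ?thesis using N(2) that by auto
qed

theorem theorem3p1:
  fixes W :: "real \<Rightarrow> complex^'n^'n"
    and A :: "complex^'n^'n"
    and \<gamma> :: "real^'n^'n"
  assumes "type1_matrix_power_function W A \<gamma>"
  shows "(AE x in lebesgue. positive_definite (W x)) \<longleftrightarrow>
         positive_definite A \<and>
         (\<forall>i j. A $ i $ j \<noteq> 0 \<longrightarrow> \<gamma> $ i $ j = (\<gamma> $ i $ i + \<gamma> $ j $ j) / 2)"
    (is "?ae \<longleftrightarrow> positive_definite A \<and> ?avg")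
proof -
  have W: "W x $ i $ j = A $ i $ j * complex_of_real (\<bar>x\<bar> powr (\<gamma> $ i $ j))" if "x \<noteq> 0" for x i j
    using assms that unfolding type1_matrix_power_function_def by blast
  have pd_iff: "positive_definite (W x) \<longleftrightarrow> positive_definite A" if avg: ?avg and x: "x \<noteq> 0" for x
  proof (rule positive_definite_diagonal_congruence_iff[of "\<lambda>i. \<bar>x\<bar> powr (\<gamma> $ i $ i / 2)"])
    show "\<bar>x\<bar> powr (\<gamma> $ i $ i / 2) \<noteq> 0" for i using x by simp
    show "W x $ i $ j = complex_of_real (\<bar>x\<bar> powr (\<gamma> $ i $ i / 2)) * A $ i $ j
        * complex_of_real (\<bar>x\<bar> powr (\<gamma> $ j $ j / 2))" for i j
    proof (cases "A $ i $ j = 0")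
      case False
      then have "\<gamma> $ i $ j = \<gamma> $ i $ i / 2 + \<gamma> $ j $ j / 2" using avg by (simp add: add_divide_distrib)
      then show ?thesis by (simp add: W[OF x] powr_add)
    qed (simp add: W[OF x])
  qed
  show ?thesis
  proof
    assume ae: ?ae
    have avg: ?avg
    proof (intro allI impI)
      fix i j assume a: "A $ i $ j \<noteq> 0"
      define \<delta> where "\<delta> = \<gamma> $ i $ i + \<gamma> $ j $ j - 2 * \<gamma> $ i $ j"
      define C where "C = Re (A $ i $ i) * Re (A $ j $ j)"
      have bound: "(cmod (A $ i $ j))\<^sup>2 \<le> C * x powr \<delta>"
        if x: "0 < x" and pd: "positive_definite (W x)" for x
      proof -
        have "(cmod (A $ i $ j))\<^sup>2 * (x powr (\<gamma> $ i $ j))\<^sup>2 \<le> C * (x powr (\<gamma> $ i $ i) * x powr (\<gamma> $ j $ j))"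
          using positive_definite_entry_bound[OF pd, of i j] x
          by (simp add: W norm_mult power_mult_distrib C_def algebra_simps)
        moreover have "x powr (\<gamma> $ i $ i) * x powr (\<gamma> $ j $ j) = x powr \<delta> * (x powr (\<gamma> $ i $ j))\<^sup>2"
          by (simp add: \<delta>_def power2_eq_square powr_add[symmetric])
        ultimately have "(cmod (A $ i $ j))\<^sup>2 * (x powr (\<gamma> $ i $ j))\<^sup>2 \<le> (C * x powr \<delta>) * (x powr (\<gamma> $ i $ j))\<^sup>2"
          by (simp add: mult.assoc)
        then show ?thesis using x by simp
      qed
      have "\<delta> = 0"
      proof (rule ccontr)
        assume \<delta>: "\<delta> \<noteq> 0"
        define e where "e = (cmod (A $ i $ j))\<^sup>2"
        have e: "0 < e" using a by (simp add: e_def)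
        define S where "S = {x\<in>{0<..}. C * x powr \<delta> < e}"
        have "open S"
        proof -
          have "S = {0<..} \<inter> (\<lambda>x. C * x powr \<delta>) -` {..<e}" by (auto simp: S_def)
          moreover have "open \<dots>"
            by (intro continuous_open_preimage) (auto intro!: continuous_intros)
          ultimately show ?thesis by simp
        qed
        \<comment> \<open>This point, where \<open>x powr \<delta> = e / (2 * \<bar>C\<bar> + 1)\<close>, serves for either sign of \<open>\<delta>\<close>.\<close>
        moreover have "(e / (2 * \<bar>C\<bar> + 1)) powr (1 / \<delta>) \<in> S"
        proof -
          have "C * e < e * (2 * \<bar>C\<bar> + 1)"
            using e by (subst mult.commute, intro mult_strict_left_mono) auto
          moreover have D: "0 < 2 * \<bar>C\<bar> + 1" by linarith
          ultimately have "C * (e / (2 * \<bar>C\<bar> + 1)) < e" by (simp add: pos_divide_less_eq)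
          moreover have "0 < e / (2 * \<bar>C\<bar> + 1)" using e D by simp
          ultimately show ?thesis using \<delta> e D by (simp add: S_def powr_powr)
        qed
        ultimately obtain x where "x \<in> S" "positive_definite (W x)"
          using AE_lebesgue_meets_open[OF ae, of S] by blast
        then show False using bound[of x] by (auto simp: S_def e_def)
      qed
      then show "\<gamma> $ i $ j = (\<gamma> $ i $ i + \<gamma> $ j $ j) / 2" by (simp add: \<delta>_def)
    qed
    obtain x where "x \<in> {0::real<..}" "positive_definite (W x)"
      using AE_lebesgue_meets_open[OF ae, of "{0<..}"] by auto
    then have "positive_definite A" using pd_iff[OF avg, of x] by auto
    with avg show "positive_definite A \<and> ?avg" by blast
  next
    assume R: "positive_definite A \<and> ?avg"
    then have "\<And>x. x \<noteq> 0 \<Longrightarrow> positive_definite (W x)" using pd_iff by blast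
    moreover have "AE x in lebesgue. x \<noteq> (0::real)"
      by (rule AE_I'[of "{0}"]) (auto simp: negligible_iff_null_sets[symmetric])
    ultimately show ?ae by (auto elim: eventually_mono)
  qed
qed

end
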